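(* Consider an indexing scheme for $(c,k)$-NN in $d$-dimensional $\ell_\infty$ space with $c<3$ and with worst case query time $\lceil k/\alpha \rceil$ I/Os, where $1 \leq \alpha \leq B$. For sufficiently large $d = O(k \log(n/k))$, the indexing scheme must use $\Omega \left(\left(\frac{1}{2e}\sqrt{\frac{n \alpha}{k B}} \right)^{\alpha}\right)$ blocks of space.
   Context: Setting: the indexability model of Hellerstein et al. A workload $W=(D,I,\mathcal{Q})$ consists of a domain $D$, a finite instance $I\subseteq D$ of size $n$, and a query set $\mathcal{Q}$ of subsets of $I$. An indexing scheme consists of a workload together with a set $\mathcal{B}$ of $B$-element subsets of $I$ (blocks), where $B$ is the block size. The space usage is the number of blocks $|\mathcal{B}|$; the query time (number of I/Os) of a query is the size of a minimum set of blocks whose union contains a valid answer to the query (the blocks are given for free; no search cost is counted). Data items are indivisible. The $(c,k)$-NN problem ($c$-approximate $k$-nearest neighbors): given a set $P$ of $n$ points in a metric space with distance $d(\cdot,\cdot)$, a constant $c>1$ and a positive integer $k\le n$, for a query $q$ one must return $k$ points $q^1,\dots,q^k\in P$ with $d(q,q^i)\le c\, d(q,p^k_q)$ for all $i$, where $p^k_q$ is the $k$th nearest neighbor of $q$ in $P$. Any $k$ points satisfying this are a valid answer. The indexing scheme may depend on $c$ and $k$. Here the metric is $\ell_\infty$ on $\mathbb{R}^d$, and $B$ denotes the number of vectors that fit in a block.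
   Formalization: The condition α ≤ 2k is added to 1 ≤ α ≤ B: without it the claim fails, e.g. for k = 1, α = B = 3, where ⌈n/3⌉ blocks covering all points answer every query in one I/O but the claimed bound is of order n^{3/2}. *)

theory Defs
  imports Complex_Main "HOL-Library.FuncSet" "HOL-Library.Multiset" "HOL-Library.Extended_Nat"
begin

definition linf_space :: "nat \<Rightarrow> (nat \<Rightarrow> real) set" where
  "linf_space d = {..<d} \<rightarrow>\<^sub>E UNIV"

definition linf_dist :: "nat \<Rightarrow> (nat \<Rightarrow> real) \<Rightarrow> (nat \<Rightarrow> real) \<Rightarrow> real" where
  "linf_dist d x y = Max (insert 0 ((\<lambda>i. \<bar>x i - y i\<bar>) ` {..<d}))"

text \<open>A query of an approximate problem may have several valid answers, so it is represented
  by the set of its valid answers. An exact query with answer \<open>A \<subseteq> I\<close> is the singleton \<open>{A}\<close>.\<close>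

definition workload :: "'a set \<Rightarrow> 'a set \<Rightarrow> 'a set set set \<Rightarrow> bool" where
  "workload D I Q \<longleftrightarrow> I \<subseteq> D \<and> finite I \<and> (\<forall>q\<in>Q. q \<subseteq> Pow I)"

definition indexing_scheme ::
  "'a set \<Rightarrow> 'a set \<Rightarrow> 'a set set set \<Rightarrow> nat \<Rightarrow> 'a set set \<Rightarrow> bool" where
  "indexing_scheme D I Q B \<B> \<longleftrightarrow> workload D I Q \<and> (\<forall>b\<in>\<B>. b \<subseteq> I \<and> card b = B)"

text \<open>The values are in \<^typ>\<open>enat\<close> so that a query none of whose valid answers is covered by
  the blocks has query time \<open>\<infinity>\<close>.\<close>

definition query_time :: "'a set set \<Rightarrow> 'a set set \<Rightarrow> enat" where
  "query_time \<B> q =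
     (INF \<C> \<in> {\<C>. \<C> \<subseteq> \<B> \<and> finite \<C> \<and> (\<exists>A\<in>q. A \<subseteq> \<Union>\<C>)}. enat (card \<C>))"

definition worst_case_query_time :: "'a set set \<Rightarrow> 'a set set set \<Rightarrow> enat" where
  "worst_case_query_time \<B> Q = (SUP q\<in>Q. query_time \<B> q)"

text \<open>The \<open>k\<close>th smallest of the distances from \<open>q\<close> to the points of \<open>P\<close>, counted with
  multiplicity; meaningful for \<open>1 \<le> k \<le> card P\<close>.\<close>

definition kth_nn_dist :: "('a \<Rightarrow> 'a \<Rightarrow> real) \<Rightarrow> 'a set \<Rightarrow> nat \<Rightarrow> 'a \<Rightarrow> real" where
  "kth_nn_dist dst P k q = sorted_list_of_multiset (image_mset (dst q) (mset_set P)) ! (k - 1)"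

definition nn_valid_answers ::
  "('a \<Rightarrow> 'a \<Rightarrow> real) \<Rightarrow> real \<Rightarrow> nat \<Rightarrow> 'a set \<Rightarrow> 'a \<Rightarrow> 'a set set" where
  "nn_valid_answers dst c k P q =
     {A. A \<subseteq> P \<and> card A = k \<and> (\<forall>p\<in>A. dst q p \<le> c * kth_nn_dist dst P k q)}"

definition linf_nn_queries ::
  "nat \<Rightarrow> real \<Rightarrow> nat \<Rightarrow> (nat \<Rightarrow> real) set \<Rightarrow> (nat \<Rightarrow> real) set set set" where
  "linf_nn_queries d c k P = nn_valid_answers (linf_dist d) c k P ` linf_space d"

end

theory Submission imports Defs begin

text \<open>Split the points into \<open>k\<close> groups of \<open>m = n div k\<close> points, each group owning \<open>O(log m)\<close>
  coordinates in which its points carry distinct codes with entries \<open>0\<close> and \<open>2\<close>, each bit being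
  stored together with its complement, while all other groups are \<open>0\<close> there. For every choice of
  one point per group, the vector that is \<open>1\<close> where the chosen point of the owning group is \<open>2\<close> and
  \<open>-1\<close> elsewhere has distance \<open>1\<close> to the chosen points and at least \<open>3\<close> to all others, so that each
  of the \<open>m ^ k\<close> transversals is the only valid answer to some query. A transversal covered by
  \<open>\<lceil>k / \<alpha>\<rceil>\<close> blocks meets one of them in at least \<open>s = \<lceil>\<alpha> / 2\<rceil>\<close> points, and a block of size \<open>B\<close>
  can serve at most \<open>(B choose s) * m ^ (k - s)\<close> transversals in this way.\<close>

subsection \<open>Counting transversals\<close>

text \<open>A member of the set has a graph containing \<open>U\<close>, so \<open>fst\<close> is
  injective on \<open>U\<close> and the values at \<open>card U\<close> indices are prescribed. Only
  the restriction to the remaining indices is free.\<close>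

lemma card_PiE_through_le:
  assumes "finite J" "finite X" "finite U" "U \<subseteq> J \<times> X"
  shows "card {\<sigma> \<in> J \<rightarrow>\<^sub>E X. \<forall>(j,x)\<in>U. \<sigma> j = x} \<le> card X ^ (card J - card U)"
proof (cases "{\<sigma> \<in> J \<rightarrow>\<^sub>E X. \<forall>(j,x)\<in>U. \<sigma> j = x} = {}")
  case False
  let ?F = "{\<sigma> \<in> J \<rightarrow>\<^sub>E X. \<forall>(j,x)\<in>U. \<sigma> j = x}"
  let ?R = "J - fst ` U"
  have "inj_on fst U"
  proof -
    obtain \<sigma> where "\<And>z. z \<in> U \<Longrightarrow> \<sigma> (fst z) = snd z"
      using False by fastforce
    then show ?thesis
      by (metis inj_onI prod_eqI)
  qed
  then have cU: "card (fst ` U) = card U"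
    by (rule card_image)
  have sub: "fst ` U \<subseteq> J"
    using assms(4) by auto
  have "inj_on (\<lambda>\<sigma>. restrict \<sigma> ?R) ?F"
  proof (rule inj_onI)
    fix \<sigma> \<tau>
    assume a: "\<sigma> \<in> ?F" "\<tau> \<in> ?F" and eq: "restrict \<sigma> ?R = restrict \<tau> ?R"
    have "\<sigma> j = \<tau> j" if "j \<in> J" for j
    proof (cases "j \<in> fst ` U")
      case True
      then show ?thesis using a by force
    next
      case False
      then show ?thesis using that fun_cong[OF eq, of j] by simp
    qed
    with a show "\<sigma> = \<tau>"
      by (intro PiE_ext[of \<sigma> J "\<lambda>_. X" \<tau>]) auto
  qed
  moreover have "(\<lambda>\<sigma>. restrict \<sigma> ?R) ` ?F \<subseteq> ?R \<rightarrow>\<^sub>E X"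
    unfolding image_subset_iff restrict_PiE_iff by auto
  moreover have "finite (?R \<rightarrow>\<^sub>E X)"
    using assms by (intro finite_PiE) auto
  ultimately have "card ?F \<le> card (?R \<rightarrow>\<^sub>E X)"
    by (rule card_inj_on_le)
  also have "\<dots> = card X ^ (card J - card U)"
    using assms sub cU by (simp add: card_PiE card_Diff_subset)
  finally show ?thesis .
next
  case True
  show ?thesis
    unfolding True by simp
qed

text \<open>Union bound over the \<open>s\<close>-element subsets of \<open>T\<close>: a graph that
  meets \<open>T\<close> in at least \<open>s\<close> points contains one of them.\<close>

lemma card_PiE_meeting_le:
  assumes "finite J" "finite X" "finite T" "T \<subseteq> J \<times> X"
  shows "card {\<sigma> \<in> J \<rightarrow>\<^sub>E X. s \<le> card {j \<in> J. (j, \<sigma> j) \<in> T}}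
    \<le> (card T choose s) * card X ^ (card J - s)"
proof -
  let ?F = "\<lambda>U. {\<sigma> \<in> J \<rightarrow>\<^sub>E X. \<forall>(j,x)\<in>U. \<sigma> j = x}"
  let ?\<U> = "{U. U \<subseteq> T \<and> card U = s}"
  have fin: "finite ?\<U>"
    using assms(3) by simp
  have finF: "finite (?F U)" for U
    using assms by (intro finite_subset[OF _ finite_PiE[of J "\<lambda>_. X"]]) auto
  have "{\<sigma> \<in> J \<rightarrow>\<^sub>E X. s \<le> card {j \<in> J. (j, \<sigma> j) \<in> T}} \<subseteq> (\<Union>U\<in>?\<U>. ?F U)"
  proof clarify
    fix \<sigma> assume \<sigma>: "\<sigma> \<in> J \<rightarrow>\<^sub>E X" "s \<le> card {j \<in> J. (j, \<sigma> j) \<in> T}"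
    then obtain V where V: "V \<subseteq> {j \<in> J. (j, \<sigma> j) \<in> T}" "card V = s"
      by (meson obtain_subset_with_card_n)
    let ?U = "(\<lambda>j. (j, \<sigma> j)) ` V"
    have "card ?U = s"
      using V(2) by (subst card_image) (auto simp: inj_on_def)
    then have "?U \<in> ?\<U>" "\<sigma> \<in> ?F ?U"
      using V(1) \<sigma> by auto
    then show "\<sigma> \<in> (\<Union>U\<in>?\<U>. ?F U)"
      by blast
  qed
  then have "card {\<sigma> \<in> J \<rightarrow>\<^sub>E X. s \<le> card {j \<in> J. (j, \<sigma> j) \<in> T}} \<le> card (\<Union>U\<in>?\<U>. ?F U)"
    using fin finF by (intro card_mono finite_UN_I)
  also have "\<dots> \<le> (\<Sum>U\<in>?\<U>. card (?F U))"
    using fin by (rule card_UN_le)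
  also have "\<dots> \<le> (\<Sum>U\<in>?\<U>. card X ^ (card J - s))"
  proof (rule sum_mono)
    fix U assume "U \<in> ?\<U>"
    then show "card (?F U) \<le> card X ^ (card J - s)"
      using card_PiE_through_le[OF assms(1,2), of U] assms(3,4) finite_subset by fastforce
  qed
  also have "\<dots> = (card T choose s) * card X ^ (card J - s)"
    using assms(3) by (simp add: n_subsets)
  finally show ?thesis .
qed

text \<open>Every one of the \<open>card X ^ card J\<close> functions is charged to a block, and a
  block receives at most \<open>(B choose s) * card X ^ (card J - s)\<close> of them. Cancelling the
  common power removes \<open>card J\<close> from the bound.\<close>

lemma blocks_lower_bound:
  fixes p :: "'i \<Rightarrow> 'x \<Rightarrow> 'a"
  assumes "finite J" "finite X" "X \<noteq> {}" "s \<le> card J"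
    and inj: "inj_on (case_prod p) (J \<times> X)"
    and "finite \<B>" and \<B>: "\<And>b. b \<in> \<B> \<Longrightarrow> finite b \<and> card b = B"
    and meet: "\<And>\<sigma>. \<sigma> \<in> J \<rightarrow>\<^sub>E X \<Longrightarrow> \<exists>b\<in>\<B>. s \<le> card {j \<in> J. p j (\<sigma> j) \<in> b}"
  shows "card X ^ s \<le> card \<B> * (B choose s)"
proof -
  \<comment> \<open>The block pulled back to index pairs; injectivity of \<open>p\<close> keeps its
    size at most \<open>B\<close>.\<close>
  define T where "T b = {z \<in> J \<times> X. case_prod p z \<in> b}" for b
  let ?M = "\<lambda>b. {\<sigma> \<in> J \<rightarrow>\<^sub>E X. s \<le> card {j \<in> J. (j, \<sigma> j) \<in> T b}}"
  have M: "card (?M b) \<le> (B choose s) * card X ^ (card J - s)" if "b \<in> \<B>" for b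
  proof -
    have "card (T b) = card (case_prod p ` T b)"
      by (rule card_image[symmetric], rule inj_on_subset[OF inj]) (auto simp: T_def)
    also have "\<dots> \<le> card b"
      using \<B>[OF that] by (intro card_mono) (auto simp: T_def)
    finally have "card (T b) choose s \<le> B choose s"
      using \<B>[OF that] binomial_right_mono by auto
    moreover have "T b \<subseteq> J \<times> X"
      by (auto simp: T_def)
    moreover have "finite (T b)"
      using assms(1,2) by (simp add: T_def)
    ultimately show ?thesis
      using card_PiE_meeting_le[OF assms(1,2), of "T b" s] le_trans mult_le_mono1 by blast
  qed
  have "J \<rightarrow>\<^sub>E X \<subseteq> (\<Union>b\<in>\<B>. ?M b)"
  proof
    fix \<sigma> assume \<sigma>: "\<sigma> \<in> J \<rightarrow>\<^sub>E X"
    then obtain b where "b \<in> \<B>" "s \<le> card {j \<in> J. p j (\<sigma> j) \<in> b}"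
      using meet by blast
    moreover have "{j \<in> J. p j (\<sigma> j) \<in> b} = {j \<in> J. (j, \<sigma> j) \<in> T b}"
      using \<sigma> by (auto simp: T_def)
    ultimately show "\<sigma> \<in> (\<Union>b\<in>\<B>. ?M b)"
      using \<sigma> by auto
  qed
  moreover have "finite (\<Union>b\<in>\<B>. ?M b)"
    using assms(1,2,6) by (auto intro: finite_subset[OF _ finite_PiE[of J "\<lambda>_. X"]])
  ultimately have "card (J \<rightarrow>\<^sub>E X) \<le> card (\<Union>b\<in>\<B>. ?M b)"
    by (rule card_mono[rotated])
  also have "\<dots> \<le> (\<Sum>b\<in>\<B>. card (?M b))"
    using assms(6) by (rule card_UN_le)
  also have "\<dots> \<le> (\<Sum>b\<in>\<B>. (B choose s) * card X ^ (card J - s))"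
    using M by (rule sum_mono)
  finally have "card X ^ card J \<le> card \<B> * (B choose s) * card X ^ (card J - s)"
    using assms(1) by (simp add: card_PiE)
  moreover have "card X ^ card J = card X ^ s * card X ^ (card J - s)"
    using assms(4) by (simp flip: power_add)
  moreover have "card X ^ (card J - s) > 0"
    using assms(2,3) by (simp add: card_gt_0_iff)
  ultimately show ?thesis
    by (metis mult_le_cancel2)
qed

text \<open>Combines \<open>(n choose s) * fact s \<le> n ^ s\<close> with
  \<open>s ^ s / fact s \<le> exp s\<close>, where the left side of the latter is a single term of
  the exponential series.\<close>

lemma binomial_le_exp_power:
  assumes "s > 0"
  shows "real (n choose s) \<le> (exp 1 * real n / real s) ^ s"
proof -
  have "real s ^ s / fact s \<le> exp (real s)"
  proof -
    have "(\<Sum>i\<in>{s}. real s ^ i /\<^sub>R fact i) \<le> (\<Sum>i. real s ^ i /\<^sub>R fact i)"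
      by (rule sum_le_suminf) (use summable_exp_generic[of "real s"] in auto)
    then show ?thesis
      by (simp add: exp_def field_simps)
  qed
  then have *: "real s ^ s \<le> exp 1 ^ s * fact s"
    by (simp add: field_simps flip: exp_of_nat_mult)
  have "real ((n choose s) * fact s) \<le> real (n ^ s)"
    unfolding of_nat_le_iff by (rule binomial_fact_pow)
  then have "real (n choose s) * fact s * exp 1 ^ s \<le> real n ^ s * exp 1 ^ s"
    by (intro mult_right_mono) auto
  moreover have "real (n choose s) * real s ^ s \<le> real (n choose s) * (exp 1 ^ s * fact s)"
    using * by (rule mult_left_mono) simp
  ultimately have "real (n choose s) * real s ^ s \<le> (exp 1 * real n) ^ s"
    unfolding power_mult_distrib by (simp only: mult_ac)
  then show ?thesis
    using assms by (simp add: power_divide field_simps)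
qed

subsection \<open>Queries and their answers\<close>

text \<open>Were entry \<open>k - 1\<close>, counted from 0, above \<open>r\<close>, only the
  \<open>k - 1\<close> positions before it could hold entries at most \<open>r\<close>.\<close>

lemma sorted_nth_le_if_length_filter:
  assumes "sorted xs" "1 \<le> k" "k \<le> length (filter (\<lambda>x. x \<le> r) xs)"
  shows "xs ! (k - 1) \<le> (r::'a::linorder)"
proof (rule ccontr)
  assume gr: "\<not> xs ! (k - 1) \<le> r"
  have "{i. i < length xs \<and> xs ! i \<le> r} \<subseteq> {..<k - 1}"
  proof
    fix i assume i: "i \<in> {i. i < length xs \<and> xs ! i \<le> r}"
    show "i \<in> {..<k - 1}"
      using gr i sorted_nth_mono[OF assms(1), of "k - 1" i] by (cases "k - 1 \<le> i") auto
  qed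
  then have "card {i. i < length xs \<and> xs ! i \<le> r} \<le> k - 1"
    using card_mono[of "{..<k - 1}"] by fastforce
  then show False
    using assms(2,3) by (simp add: length_filter_conv_card)
qed

lemma kth_nn_dist_le:
  assumes "finite P" "A \<subseteq> P" "card A = k" "1 \<le> k" "\<And>p. p \<in> A \<Longrightarrow> dst q p \<le> r"
  shows "kth_nn_dist dst P k q \<le> r"
proof -
  let ?M = "image_mset (dst q) (mset_set P)"
  have "length (filter (\<lambda>x. x \<le> r) (sorted_list_of_multiset ?M)) = size (filter_mset (\<lambda>x. x \<le> r) ?M)"
    by (metis mset_filter mset_sorted_list_of_multiset size_mset)
  also have "\<dots> = card {p \<in> P. dst q p \<le> r}"
    using assms(1) by (simp add: filter_mset_image_mset filter_mset_mset_set)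
  also have "\<dots> \<ge> card A"
    using assms by (intro card_mono) auto
  finally show ?thesis
    unfolding kth_nn_dist_def using assms(3,4)
    by (intro sorted_nth_le_if_length_filter) auto
qed

text \<open>The points of \<open>A\<close> push the \<open>k\<close>th distance down to at most
  \<open>r\<close>, so a valid answer stays within \<open>c * r < c' * r\<close> and cannot leave
  \<open>A\<close>; equal cardinality does the rest.\<close>

lemma nn_valid_answers_separated:
  assumes "finite P" "A \<subseteq> P" "card A = k" "1 \<le> k" "0 < r" "0 < c" "c < c'"
    and "\<And>p. p \<in> A \<Longrightarrow> dst q p \<le> r"
    and "\<And>p. p \<in> P - A \<Longrightarrow> dst q p \<ge> c' * r"
  shows "nn_valid_answers dst c k P q \<subseteq> {A}"
proof
  fix A' assume "A' \<in> nn_valid_answers dst c k P q"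
  then have A': "A' \<subseteq> P" "card A' = k" "\<And>p. p \<in> A' \<Longrightarrow> dst q p \<le> c * kth_nn_dist dst P k q"
    by (auto simp: nn_valid_answers_def)
  have "c * kth_nn_dist dst P k q \<le> c * r"
    using kth_nn_dist_le[of P A k dst q r] assms(1-4,6,8) by simp
  also have "\<dots> < c' * r"
    using assms(5,7) by simp
  finally have "A' \<subseteq> A"
    using A'(1,3) assms(9) by (meson DiffI leD le_less_trans subset_iff)
  moreover have "finite A"
    using assms(1,2) finite_subset by blast
  ultimately have "A' = A"
    using A'(2) assms(3) by (intro card_subset_eq) simp_all
  then show "A' \<in> {A}"
    by simp
qed

section \<open>Covering an answer by few blocks\<close>

text \<open>An infimum over the empty set is \<open>\<infinity>\<close>, so a finite bound yields
  some cover; as \<open>enat\<close> is well-ordered, the infimum is then attained.\<close>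

lemma query_time_leE:
  assumes "query_time \<B> q \<le> enat t"
  obtains \<C> A where "\<C> \<subseteq> \<B>" "finite \<C>" "card \<C> \<le> t" "A \<in> q" "A \<subseteq> \<Union>\<C>"
proof -
  let ?S = "{\<C>. \<C> \<subseteq> \<B> \<and> finite \<C> \<and> (\<exists>A\<in>q. A \<subseteq> \<Union>\<C>)}"
  have ne: "?S \<noteq> {}"
  proof
    assume "?S = {}"
    then have "query_time \<B> q = \<infinity>"
      unfolding query_time_def by (simp only: image_empty Inf_empty top_enat_def)
    with assms show False by simp
  qed
  then obtain \<C>\<^sub>0 where "\<C>\<^sub>0 \<in> ?S"
    by blast
  then have "Inf ((\<lambda>\<C>. enat (card \<C>)) ` ?S) \<in> (\<lambda>\<C>. enat (card \<C>)) ` ?S"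
    by (rule wellorder_InfI[OF imageI])
  then have "query_time \<B> q \<in> (\<lambda>\<C>. enat (card \<C>)) ` ?S"
    by (simp only: query_time_def)
  then obtain \<C> where "\<C> \<in> ?S" "query_time \<B> q = enat (card \<C>)"
    by (rule imageE)
  then show thesis
    using assms that by auto
qed

lemma pigeonhole_blocks:
  assumes "finite \<C>" "real (card \<C>) \<le> t" "A \<subseteq> \<Union>\<C>" "A \<noteq> {}" "t * a \<le> real (card A)"
  shows "\<exists>b\<in>\<C>. a \<le> real (card (A \<inter> b))"
proof (rule ccontr)
  assume "\<not> ?thesis"
  then have less: "\<And>b. b \<in> \<C> \<Longrightarrow> real (card (A \<inter> b)) < a"
    by force
  have ne: "\<C> \<noteq> {}"
    using assms(3,4) by auto
  \<comment> \<open>A block exists and its nonnegative count lies below \<open>a\<close>. Positivity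
    lets \<open>card \<C>\<close> be replaced by its upper bound \<open>t\<close> below.\<close>
  then have "0 < a"
    using less by (meson all_not_in_conv le_less_trans of_nat_0_le_iff)
  have "A = (\<Union>b\<in>\<C>. A \<inter> b)"
    using assms(3) by auto
  then have "card A \<le> (\<Sum>b\<in>\<C>. card (A \<inter> b))"
    using card_UN_le[OF assms(1), of "\<lambda>b. A \<inter> b"] by simp
  then have "real (card A) \<le> (\<Sum>b\<in>\<C>. real (card (A \<inter> b)))"
    by (simp flip: of_nat_sum)
  also have "\<dots> < (\<Sum>b\<in>\<C>. a)"
    using assms(1) ne less by (rule sum_strict_mono)
  also have "\<dots> \<le> t * a"
    using assms(2) \<open>0 < a\<close> by simp
  finally show False
    using assms(5) by simp
qed

text \<open>The loss from rounding up is the source of the factor 1/2: for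
  \<open>\<alpha> \<le> k\<close> the ceiling adds at most 1, and
  \<open>(k / \<alpha> + 1) * (\<alpha> / 2) = (k + \<alpha>) / 2\<close>. For larger
  \<open>\<alpha>\<close> the ceiling is 1 and \<open>\<alpha> \<le> 2 * k\<close> is the
  claim.\<close>

lemma ceiling_divide_mult_half_le:
  assumes "1 \<le> \<alpha>" "\<alpha> \<le> 2 * k" "0 < k"
  shows "real (nat \<lceil>k / \<alpha>\<rceil>) * (\<alpha> / 2) \<le> k"
proof -
  have pos: "0 < k / \<alpha>"
    using assms by simp
  have t: "real (nat \<lceil>k / \<alpha>\<rceil>) = of_int \<lceil>k / \<alpha>\<rceil>"
    using pos by (simp add: of_nat_nat less_imp_le)
  show ?thesis
  proof (cases "\<alpha> \<le> k")
    case True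
    have "of_int \<lceil>k / \<alpha>\<rceil> * (\<alpha> / 2) \<le> (k / \<alpha> + 1) * (\<alpha> / 2)"
      using assms by (intro mult_right_mono of_int_ceiling_le_add_one) auto
    also have "\<dots> = (k + \<alpha>) / 2"
      using assms by (simp add: field_simps)
    also have "\<dots> \<le> k"
      using True by simp
    finally show ?thesis
      unfolding t .
  next
    case False
    then have "\<lceil>k / \<alpha>\<rceil> = 1"
      using pos assms by (intro ceiling_unique) auto
    then show ?thesis
      using assms by simp
  qed
qed

subsection \<open>The point set\<close>

lemma restrict_in_linf_space: "restrict f {..<d} \<in> linf_space d"
  by (simp add: linf_space_def)

lemma linf_dist_le:
  assumes "0 \<le> r" "\<And>i. i < d \<Longrightarrow> \<bar>x i - y i\<bar> \<le> r"
  shows "linf_dist d x y \<le> r"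
  unfolding linf_dist_def using assms by (subst Max_le_iff) auto

lemma linf_dist_ge:
  assumes "i < d" "r \<le> \<bar>x i - y i\<bar>"
  shows "r \<le> linf_dist d x y"
  unfolding linf_dist_def using assms by (subst Max_ge_iff) auto

text \<open>Coordinate \<open>i\<close> belongs to group \<open>i div (2 * L)\<close> and there to
  bit \<open>(i mod (2 * L)) div 2\<close>; the odd coordinate of a bit carries the bit, the even
  one its complement. A code is the set \<open>e x\<close> of its one-bits. Owing to the
  complements, of two different codes within \<open>{..<L}\<close> each has a 2 where the other has
  a 0.\<close>

definition code_entry :: "nat \<Rightarrow> (nat \<Rightarrow> nat set) \<Rightarrow> nat \<Rightarrow> nat \<Rightarrow> nat \<Rightarrow> real" where
  "code_entry L e j x i =
     (if i div (2 * L) = j \<and> (odd i \<longleftrightarrow> (i mod (2 * L)) div 2 \<in> e x) then 2 else 0)"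

definition code_point :: "nat \<Rightarrow> nat \<Rightarrow> (nat \<Rightarrow> nat set) \<Rightarrow> nat \<Rightarrow> nat \<Rightarrow> nat \<Rightarrow> real" where
  "code_point d L e j x = restrict (code_entry L e j x) {..<d}"

text \<open>The entry 1 is at distance 1 from both 0 and 2, while -1 is at distance 1 from 0 and 3
  from 2. Hence only a 2 where the selected point of that group has a 0 is penalised.\<close>

definition code_query :: "nat \<Rightarrow> nat \<Rightarrow> (nat \<Rightarrow> nat set) \<Rightarrow> (nat \<Rightarrow> nat) \<Rightarrow> nat \<Rightarrow> real" where
  "code_query d L e \<sigma> =
     restrict (\<lambda>i. if code_entry L e (i div (2 * L)) (\<sigma> (i div (2 * L))) i = 2 then 1 else -1) {..<d}"

lemma linf_dist_code_query_selected:
  "linf_dist d (code_query d L e \<sigma>) (code_point d L e j (\<sigma> j)) \<le> 1"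
  by (rule linf_dist_le) (auto simp: code_query_def code_point_def code_entry_def)

lemma linf_dist_code_query_unselected:
  assumes "e x \<noteq> e (\<sigma> j)" "e x \<subseteq> {..<L}" "e (\<sigma> j) \<subseteq> {..<L}" "j < k" "2 * k * L \<le> d"
  shows "3 \<le> linf_dist d (code_query d L e \<sigma>) (code_point d L e j x)"
proof -
  obtain l where l: "l < L" "l \<in> e x \<longleftrightarrow> l \<notin> e (\<sigma> j)"
    using assms(1-3) by blast
  \<comment> \<open>Of the two coordinates of bit \<open>l\<close>, the offset picks the one where
    the point of \<open>x\<close> has a 2 and the selected point has a 0, so that the query is -1
    there.\<close>
  define i where "i = j * (2 * L) + (2 * l + of_bool (l \<in> e x))"
  have low: "2 * l + of_bool (l \<in> e x) < 2 * L"
    using l(1) by (auto simp: of_bool_def)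
  have "i < (j + 1) * (2 * L)"
    using low by (simp add: i_def)
  also have "\<dots> \<le> k * (2 * L)"
    using assms(4) by (intro mult_right_mono) auto
  finally have "i < d"
    using assms(5) by (simp add: mult_ac)
  have i_div: "i div (2 * L) = j" and i_mod: "(i mod (2 * L)) div 2 = l"
    using low l(1) by (auto simp: i_def div_mult_self3)
  have "odd i \<longleftrightarrow> l \<in> e x"
    by (simp add: i_def)
  then have "code_entry L e j x i = 2" "code_entry L e j (\<sigma> j) i = 0"
    using i_div i_mod l(2) by (auto simp: code_entry_def)
  then show ?thesis
    using \<open>i < d\<close> i_div by (intro linf_dist_ge[of i]) (auto simp: code_query_def code_point_def)
qed

lemma linf_dist_code_query_far:
  assumes "1 \<le> d" "4 \<le> v"
  shows "3 \<le> linf_dist d (code_query d L e \<sigma>) (restrict (\<lambda>_. v) {..<d})"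
  using assms by (intro linf_dist_ge[of 0]) (auto simp: code_query_def)

text \<open>Equal points are equally far from every query, while a query selecting just one of two
  points sees distances at most 1 and at least 3. So it suffices to exhibit such a query for
  different indices.\<close>

lemma inj_on_code_point:
  assumes "inj_on e X" "\<And>x. x \<in> X \<Longrightarrow> e x \<subseteq> {..<L}" "2 * k * L \<le> d"
    and "\<not> is_singleton X"
  shows "inj_on (case_prod (code_point d L e)) ({..<k} \<times> X)"
proof (rule inj_onI, clarify)
  fix j x j' x'
  assume a: "j < k" "x \<in> X" "j' < k" "x' \<in> X" "code_point d L e j x = code_point d L e j' x'"
  obtain y where y: "y \<in> X" "y \<noteq> x"
    using assms(4) a(2) by (metis is_singletonI' empty_iff)
  have eq_dist: "linf_dist d (code_query d L e \<sigma>) (code_point d L e j x)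
      = linf_dist d (code_query d L e \<sigma>) (code_point d L e j' x')" for \<sigma>
    using a(5) by simp
  have "j = j'"
  proof (rule ccontr)
    assume "j \<noteq> j'"
    \<comment> \<open>Selects \<open>x'\<close> in group \<open>j'\<close> but \<open>y\<close>,
      which differs from \<open>x\<close>, in group \<open>j\<close>.\<close>
    define \<sigma> where "\<sigma> = (\<lambda>_. x')(j := y)"
    have "e x \<noteq> e (\<sigma> j)"
      using assms(1) a(2) y by (auto simp: \<sigma>_def inj_on_def)
    moreover have "e (\<sigma> j) \<subseteq> {..<L}"
      using assms(2) y(1) by (simp add: \<sigma>_def)
    ultimately have "3 \<le> linf_dist d (code_query d L e \<sigma>) (code_point d L e j x)"
      using assms(2,3) a(1,2) by (intro linf_dist_code_query_unselected) auto
    moreover have "\<sigma> j' = x'"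
      using \<open>j \<noteq> j'\<close> by (simp add: \<sigma>_def)
    ultimately show False
      using linf_dist_code_query_selected[of d L e \<sigma> j'] eq_dist[of \<sigma>] by simp
  qed
  moreover have "x = x'"
  proof (rule ccontr)
    assume "x \<noteq> x'"
    then have "e x' \<noteq> e x"
      using assms(1) a(2,4) by (auto simp: inj_on_def)
    then have "3 \<le> linf_dist d (code_query d L e (\<lambda>_. x)) (code_point d L e j' x')"
      using assms(2,3) a by (intro linf_dist_code_query_unselected) auto
    then show False
      using linf_dist_code_query_selected[of d L e "\<lambda>_. x" j] eq_dist[of "\<lambda>_. x"] by simp
  qed
  ultimately show "j = j' \<and> x = x'" ..
qed

text \<open>The constant vectors pad the point set to exactly \<open>n\<close> points without affecting any query.\<close>

lemma exists_points_with_transversal_queries: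
  assumes "2 \<le> m" "k * m \<le> n" "m \<le> 2 ^ L" "2 * k * L \<le> d" "1 \<le> d"
  obtains P p where "P \<subseteq> linf_space d" "finite P" "card P = n"
    "inj_on (case_prod p) ({..<k} \<times> {..<m})"
    "\<And>c \<sigma>. \<lbrakk>1 \<le> k; 0 < c; c < 3; \<sigma> \<in> {..<k} \<rightarrow>\<^sub>E {..<m}\<rbrakk> \<Longrightarrow>
       \<exists>q\<in>linf_space d. nn_valid_answers (linf_dist d) c k P q \<subseteq> {(\<lambda>j. p j (\<sigma> j)) ` {..<k}}"
proof -
  have "card {..<m} \<le> card (Pow {..<L})"
    using assms(3) by (simp add: card_Pow)
  then obtain e where e: "inj_on e {..<m}" "e ` {..<m} \<subseteq> Pow {..<L}"
    using inj_on_iff_card_le[of "{..<m}" "Pow {..<L}"] by auto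
  then have eL: "e x \<subseteq> {..<L}" if "x < m" for x
    using that by blast
  let ?p = "code_point d L e"
  \<comment> \<open>Query entries are at most 1, so a constant of at least 4 is at distance at least
    3. It also exceeds all code entries, which keeps the padding disjoint from the code points; the
    summand \<open>r\<close> makes the padding vectors distinct.\<close>
  define far where "far r = restrict (\<lambda>_. 4 + real r) {..<d}" for r
  define P where "P = case_prod ?p ` ({..<k} \<times> {..<m}) \<union> far ` {..<n - k * m}"
  have "\<not> is_singleton {..<m}"
    using assms(1) by (auto simp: is_singleton_altdef)
  then have inj: "inj_on (case_prod ?p) ({..<k} \<times> {..<m})"
    using e eL assms(1,4) by (intro inj_on_code_point) (auto simp: lessThan_empty_iff)
  have far0: "far r 0 = 4 + real r" for r
    using assms(5) by (simp add: far_def)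
  have inj_far: "inj far"
    by (rule injI) (metis far0 add_left_cancel of_nat_eq_iff)
  have "?p j x 0 \<le> 2" for j x
    using assms(5) by (simp add: code_point_def code_entry_def)
  then have "?p j x 0 < far r 0" for j x r
    unfolding far0 by (rule le_less_trans) simp
  then have "?p j x \<noteq> far r" for j x r
    by (metis less_irrefl)
  then have disj: "case_prod ?p ` ({..<k} \<times> {..<m}) \<inter> far ` {..<n - k * m} = {}"
    by auto
  have "card P = card ({..<k} \<times> {..<m}) + card {..<n - k * m}"
    unfolding P_def using inj inj_far disj
    by (subst card_Un_disjoint) (auto simp: card_image inj_on_subset)
  then have cP: "card P = n"
    using assms(2) by (simp add: card_cartesian_product)
  have fP: "finite P"
    by (simp add: P_def)
  have sP: "P \<subseteq> linf_space d"
    unfolding P_def far_def code_point_def using restrict_in_linf_space by auto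
  have query: "\<exists>q\<in>linf_space d. nn_valid_answers (linf_dist d) c k P q \<subseteq> {(\<lambda>j. ?p j (\<sigma> j)) ` {..<k}}"
    if c: "1 \<le> k" "0 < c" "c < 3" and \<sigma>: "\<sigma> \<in> {..<k} \<rightarrow>\<^sub>E {..<m}" for c \<sigma>
  proof (rule bexI[of _ "code_query d L e \<sigma>"])
    let ?A = "(\<lambda>j. ?p j (\<sigma> j)) ` {..<k}"
    have \<sigma>m: "\<sigma> j < m" if "j < k" for j
      using \<sigma> that by auto
    have "inj_on (\<lambda>j. ?p j (\<sigma> j)) {..<k}"
    proof (rule inj_onI)
      fix i j assume "i \<in> {..<k}" "j \<in> {..<k}" "?p i (\<sigma> i) = ?p j (\<sigma> j)"
      then show "i = j"
        using inj_onD[OF inj, of "(i, \<sigma> i)" "(j, \<sigma> j)"] \<sigma>m by simp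
    qed
    then have "card ?A = k"
      by (simp add: card_image)
    moreover have "?A \<subseteq> P"
      using \<sigma>m by (auto simp: P_def)
    moreover have "linf_dist d (code_query d L e \<sigma>) p \<ge> 3 * 1" if p: "p \<in> P - ?A" for p
    proof -
      consider j x where "j < k" "x < m" "p = ?p j x" | r where "p = far r"
        using p by (auto simp: P_def)
      then show ?thesis
      proof cases
        case 1
        then have "x \<noteq> \<sigma> j"
          using p by auto
        then have "e x \<noteq> e (\<sigma> j)"
          using e(1) 1 \<sigma>m by (auto simp: inj_on_def)
        then show ?thesis
          using 1 eL \<sigma>m assms(4) by (simp add: linf_dist_code_query_unselected)
      next
        case 2
        then show ?thesis
          using assms(5) by (simp add: far_def linf_dist_code_query_far)
      qed
    qed
    ultimately show "nn_valid_answers (linf_dist d) c k P (code_query d L e \<sigma>) \<subseteq> {?A}"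
      using c fP linf_dist_code_query_selected
      by (intro nn_valid_answers_separated[where r = 1 and c' = 3]) auto
    show "code_query d L e \<sigma> \<in> linf_space d"
      unfolding code_query_def by (rule restrict_in_linf_space)
  qed
  show thesis
    using that[OF sP fP cP inj query] .
qed

subsection \<open>The space lower bound\<close>

text \<open>As no other answer is valid, the cover supplied by the query time contains the whole
  transversal; averaging with the rounding estimate puts at least \<open>\<alpha> / 2\<close> of its
  points into one block.\<close>

lemma indexing_scheme_blocks_lower_bound:
  assumes "1 \<le> k" "2 \<le> m" "finite P"
    and inj: "inj_on (case_prod p) ({..<k} \<times> {..<m})"
    and query: "\<And>\<sigma>. \<sigma> \<in> {..<k} \<rightarrow>\<^sub>E {..<m} \<Longrightarrow> \<exists>q\<in>Q. q \<subseteq> {(\<lambda>j. p j (\<sigma> j)) ` {..<k}}"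
    and scheme: "indexing_scheme D P Q B \<B>"
    and time: "worst_case_query_time \<B> Q \<le> enat (nat \<lceil>real k / \<alpha>\<rceil>)"
    and \<alpha>: "1 \<le> \<alpha>" "\<alpha> \<le> 2 * real k"
    and s: "s = nat \<lceil>\<alpha> / 2\<rceil>"
  shows "m ^ s \<le> card \<B> * (B choose s)"
proof -
  have \<B>: "\<And>b. b \<in> \<B> \<Longrightarrow> b \<subseteq> P \<and> card b = B"
    using scheme by (auto simp: indexing_scheme_def)
  then have "finite \<B>"
    using assms(3) by (meson PowI finite_Pow_iff finite_subset subsetI)
  have "\<exists>b\<in>\<B>. s \<le> card {j \<in> {..<k}. p j (\<sigma> j) \<in> b}" if \<sigma>: "\<sigma> \<in> {..<k} \<rightarrow>\<^sub>E {..<m}" for \<sigma>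
  proof -
    let ?f = "\<lambda>j. p j (\<sigma> j)"
    have injf: "inj_on ?f {..<k}"
      using inj \<sigma> by (fastforce simp: inj_on_def)
    obtain q where q: "q \<in> Q" "q \<subseteq> {?f ` {..<k}}"
      using query[OF \<sigma>] by blast
    have "query_time \<B> q \<le> worst_case_query_time \<B> Q"
      unfolding worst_case_query_time_def using q(1) by (rule SUP_upper)
    then have "query_time \<B> q \<le> enat (nat \<lceil>real k / \<alpha>\<rceil>)"
      using time by (rule order_trans)
    then obtain \<C> A where \<C>: "\<C> \<subseteq> \<B>" "finite \<C>" "card \<C> \<le> nat \<lceil>real k / \<alpha>\<rceil>" "A \<in> q" "A \<subseteq> \<Union>\<C>"
      by (rule query_time_leE)
    have A: "A = ?f ` {..<k}"
      using \<C>(4) q(2) by blast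
    have "card A = k"
      using injf A by (simp add: card_image)
    then have "real (nat \<lceil>real k / \<alpha>\<rceil>) * (\<alpha> / 2) \<le> real (card A)"
      using ceiling_divide_mult_half_le[OF \<alpha>] assms(1) by simp
    moreover have "A \<noteq> {}"
      using A assms(1) by (auto simp: lessThan_empty_iff)
    ultimately obtain b where b: "b \<in> \<C>" "\<alpha> / 2 \<le> real (card (A \<inter> b))"
      using pigeonhole_blocks[of \<C> "real (nat \<lceil>real k / \<alpha>\<rceil>)" A "\<alpha> / 2"] \<C>(2,3,5) by auto
    have "A \<inter> b = ?f ` {j \<in> {..<k}. ?f j \<in> b}"
      using A by auto
    then have "card (A \<inter> b) = card {j \<in> {..<k}. ?f j \<in> b}"
      using card_image[OF inj_on_subset[OF injf], of "{j \<in> {..<k}. ?f j \<in> b}"] by auto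
    \<comment> \<open>An integer that is at least \<open>\<alpha> / 2\<close> is at least its
      ceiling.\<close>
    then have "s \<le> card {j \<in> {..<k}. ?f j \<in> b}"
      using b(2) s by linarith
    then show ?thesis
      using b(1) \<C>(1) by blast
  qed
  moreover have "s \<le> k"
    using \<alpha> s by linarith
  moreover have "{..<m} \<noteq> {}"
    using assms(2) by (auto simp: lessThan_empty_iff)
  moreover have "\<And>b. b \<in> \<B> \<Longrightarrow> finite b \<and> card b = B"
    using \<B> assms(3) finite_subset by blast
  ultimately have "card {..<m} ^ s \<le> card \<B> * (B choose s)"
    using inj \<open>finite \<B>\<close> by (intro blocks_lower_bound[of "{..<k}" "{..<m}" s p \<B> B]) auto
  then show ?thesis
    by simp
qed

text \<open>Serves the range in which the claimed bound is at most 1. The zero vector is an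
  arbitrary query: its answers are nonempty, so covering one takes a block.\<close>

lemma indexing_scheme_blocks_ge_1:
  assumes "1 \<le> k" "finite P"
    and scheme: "indexing_scheme D P (linf_nn_queries d c k P) B \<B>"
    and time: "worst_case_query_time \<B> (linf_nn_queries d c k P) \<le> enat t"
  shows "1 \<le> card \<B>"
proof -
  have "finite \<B>"
    using scheme assms(2) by (auto simp: indexing_scheme_def intro: finite_subset[of _ "Pow P"])
  define q :: "nat \<Rightarrow> real" where "q = restrict (\<lambda>_. 0) {..<d}"
  let ?q = "nn_valid_answers (linf_dist d) c k P q"
  have "?q \<in> linf_nn_queries d c k P"
    unfolding linf_nn_queries_def q_def by (intro imageI restrict_in_linf_space)
  then have "query_time \<B> ?q \<le> enat t"
    using time unfolding worst_case_query_time_def by (meson SUP_upper order_trans)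
  then obtain \<C> A where \<C>: "\<C> \<subseteq> \<B>" "A \<in> ?q" "A \<subseteq> \<Union>\<C>"
    by (rule query_time_leE)
  then have "A \<noteq> {}"
    using assms(1) by (auto simp: nn_valid_answers_def)
  then have "\<B> \<noteq> {}"
    using \<C> by auto
  then show ?thesis
    using \<open>finite \<B>\<close> by (simp add: Suc_le_eq card_gt_0_iff)
qed

section \<open>Numerical estimates\<close>

text \<open>\<open>L\<close> will be the number of bits of a code. The 3 arises from
  \<open>\<lceil>log 2 x\<rceil> \<le> log 2 x + 1\<close> with
  \<open>log 2 x \<le> 2 * ln x\<close>, as \<open>ln 2 \<ge> 1/2\<close>, and
  \<open>1 \<le> ln x\<close>, as \<open>exp 1 \<le> 3\<close>.\<close>

lemma bits_le_ln:
  assumes "3 \<le> (x::real)"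
  obtains L :: nat where "x \<le> 2 ^ L" "real L \<le> 3 * ln x"
proof
  let ?L = "nat \<lceil>log 2 x\<rceil>"
  have "0 \<le> log 2 x"
    using assms by simp
  then have L: "log 2 x \<le> real ?L" "real ?L \<le> log 2 x + 1"
    by linarith+
  have "x = 2 powr (log 2 x)"
    using assms by simp
  also have "\<dots> \<le> 2 powr real ?L"
    using L(1) by (rule powr_mono) simp
  finally show "x \<le> 2 ^ ?L"
    by (simp add: powr_realpow)
  have "exp 1 \<le> x"
    using exp_le assms by linarith
  then have "1 \<le> ln x"
    using assms by (simp add: ln_ge_iff)
  moreover have "log 2 x \<le> 2 * ln x"
  proof -
    have "ln 2 \<ge> (1/2::real)"
      using ln_2_less_1 ln_ge_iff[of "2::real" "1/2"] exp_half_le2 by simp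
    then have "ln x * 1 \<le> ln x * (2 * ln 2)"
      using \<open>1 \<le> ln x\<close> by (intro mult_left_mono) auto
    then show ?thesis
      by (simp add: log_def field_simps)
  qed
  ultimately show "real ?L \<le> 3 * ln x"
    using L(2) by linarith
qed

text \<open>Brings the counting bound into its final form; \<open>N\<close> stands for the number of
  blocks and \<open>x\<close> for \<open>n / k\<close>. The two halves lost in \<open>m\<close> and
  \<open>s\<close> make up the 4.\<close>

lemma blocks_estimate:
  fixes N \<alpha> x :: real
  assumes "real m ^ s \<le> N * real (B choose s)" "0 \<le> N" "s > 0" "0 < B" "\<alpha> / 2 \<le> real s"
    and "0 < \<alpha>" "x / 2 \<le> real m" "4 * (exp 1)\<^sup>2 \<le> x * \<alpha> / real B"
  shows "((1 / (2 * exp 1)) * sqrt (x * \<alpha> / real B)) powr \<alpha> \<le> N"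
proof -
  define X where "X = x * \<alpha> / real B"
  \<comment> \<open>The square of the base in the claim, which thus reads
    \<open>Y powr (\<alpha> / 2) \<le> N\<close>; \<open>1 \<le> Y\<close> permits raising the
    exponent to \<open>s\<close>.\<close>
  define Y where "Y = X / (4 * (exp 1)\<^sup>2)"
  have Y: "1 \<le> Y"
    using assms(8) unfolding X_def[symmetric] by (simp add: Y_def le_divide_eq)
  have "0 < X"
    using assms(8) unfolding X_def[symmetric] by (smt (verit) exp_gt_zero zero_less_power)
  then have "0 < x"
    using assms(4,6) by (simp add: X_def zero_less_divide_iff zero_less_mult_iff)
  \<comment> \<open>The binomial estimate accounts for one factor \<open>exp 1\<close>; the other is
    slack given up here.\<close>
  have "Y \<le> X / (4 * exp 1)"
  proof -
    have "exp 1 * 1 \<le> exp 1 * (exp 1::real)"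
      by (intro mult_left_mono) auto
    then show ?thesis
      unfolding Y_def using \<open>0 < X\<close> by (intro divide_left_mono) (auto simp: power2_eq_square)
  qed
  also have "\<dots> = (x / 2) * (\<alpha> / 2) / (exp 1 * real B)"
    by (simp add: X_def)
  also have "\<dots> \<le> real m * real s / (exp 1 * real B)"
    using assms \<open>0 < x\<close> by (intro divide_right_mono mult_mono) auto
  finally have YZ: "Y \<le> real m * real s / (exp 1 * real B)" .
  have "real m ^ s \<le> N * (exp 1 * real B / real s) ^ s"
    using assms(1,2) binomial_le_exp_power[OF assms(3), of B]
    by (meson mult_left_mono order_trans)
  then have Z: "(real m * real s / (exp 1 * real B)) ^ s \<le> N"
    using assms(3,4) by (simp add: power_divide power_mult_distrib field_simps)
  have "sqrt Y = (1 / (2 * exp 1)) * sqrt X"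
    by (simp add: Y_def real_sqrt_divide real_sqrt_mult)
  then have "((1 / (2 * exp 1)) * sqrt X) powr \<alpha> = (Y powr (1/2)) powr \<alpha>"
    using Y by (simp add: powr_half_sqrt)
  also have "\<dots> = Y powr (\<alpha> / 2)"
    by (simp add: powr_powr)
  also have "\<dots> \<le> Y powr real s"
    using Y assms(5) by (intro powr_mono) auto
  also have "\<dots> = Y ^ s"
    using Y by (simp add: powr_realpow)
  also have "\<dots> \<le> (real m * real s / (exp 1 * real B)) ^ s"
    using YZ Y by (intro power_mono) auto
  also note Z
  finally show ?thesis
    unfolding X_def .
qed

section \<open>The two ranges of the ratio \<open>n * \<alpha> / (k * B)\<close>\<close>

text \<open>The base of the power is at most 1, so a single block meets the bound and any
  \<open>n\<close> points will do; distinct constant vectors are taken.\<close>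

lemma exists_points_small_ratio:
  assumes "1 \<le> k" "1 \<le> d" "0 \<le> X" "X \<le> 4 * (exp 1)\<^sup>2" "0 \<le> \<alpha>"
  shows "\<exists>P. P \<subseteq> linf_space d \<and> finite P \<and> card P = n \<and>
    (\<forall>\<B>. indexing_scheme (linf_space d) P (linf_nn_queries d c k P) B \<B> \<longrightarrow>
       worst_case_query_time \<B> (linf_nn_queries d c k P) \<le> enat t \<longrightarrow>
       ((1 / (2 * exp 1)) * sqrt X) powr \<alpha> \<le> real (card \<B>))"
proof (intro exI conjI allI impI)
  let ?f = "\<lambda>r. restrict (\<lambda>_. real r) {..<d}"
  let ?P = "?f ` {..<n}"
  have "inj ?f"
  proof (rule injI)
    fix r r' assume "?f r = ?f r'"
    then have "?f r 0 = ?f r' 0"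
      by simp
    then show "r = r'"
      using assms(2) by simp
  qed
  then show "card ?P = n"
    by (simp add: card_image inj_on_subset)
  show "?P \<subseteq> linf_space d" "finite ?P"
    using restrict_in_linf_space by auto
  fix \<B>
  assume "indexing_scheme (linf_space d) ?P (linf_nn_queries d c k ?P) B \<B>"
    "worst_case_query_time \<B> (linf_nn_queries d c k ?P) \<le> enat t"
  then have "1 \<le> card \<B>"
    using assms by (intro indexing_scheme_blocks_ge_1) auto
  have "sqrt X \<le> 2 * exp 1"
    using assms(4) by (intro real_le_lsqrt) (auto simp: power_mult_distrib)
  then have "((1 / (2 * exp 1)) * sqrt X) powr \<alpha> \<le> 1"
    using assms by (intro powr_le1) (auto simp: field_simps)
  then show "((1 / (2 * exp 1)) * sqrt X) powr \<alpha> \<le> real (card \<B>)"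
    using \<open>1 \<le> card \<B>\<close> by linarith
qed

text \<open>The lower bound on the ratio is used twice: with \<open>\<alpha> \<le> B\<close> it
  forces \<open>n / k \<ge> 4\<close>, enough for the code construction with groups of
  \<open>n div k\<close> points, and it is the condition of the final estimate.\<close>

lemma exists_points_large_ratio:
  assumes "1 \<le> k" "1 \<le> \<alpha>" "\<alpha> \<le> real B" "\<alpha> \<le> 2 * real k" "0 < c" "c < 3" "1 \<le> d"
    and d: "real d \<ge> 6 * (real k * ln (real n / real k))"
    and X: "4 * (exp 1)\<^sup>2 \<le> (real n / real k) * \<alpha> / real B"
  shows "\<exists>P. P \<subseteq> linf_space d \<and> finite P \<and> card P = n \<and>
    (\<forall>\<B>. indexing_scheme (linf_space d) P (linf_nn_queries d c k P) B \<B> \<longrightarrow>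
       worst_case_query_time \<B> (linf_nn_queries d c k P) \<le> enat (nat \<lceil>real k / \<alpha>\<rceil>) \<longrightarrow>
       ((1 / (2 * exp 1)) * sqrt ((real n / real k) * \<alpha> / real B)) powr \<alpha> \<le> real (card \<B>))"
proof -
  define m where "m = n div k"
  have "4 * 1 \<le> 4 * (exp 1 :: real)\<^sup>2"
    by (intro mult_left_mono) (auto simp: one_le_power)
  also note X
  also have "(real n / real k) * \<alpha> / real B \<le> (real n / real k) * 1"
    using assms(2,3) by (subst times_divide_eq_right[symmetric], intro mult_left_mono) auto
  finally have nk: "4 \<le> real n / real k"
    by simp
  obtain L where L: "real n / real k \<le> 2 ^ L" "real L \<le> 3 * ln (real n / real k)"
    using bits_le_ln[of "real n / real k"] nk by auto
  have "real n / real k - 1 \<le> real m"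
    using floor_divide_of_nat_eq[of n k, where 'a = real] unfolding m_def by linarith
  \<comment> \<open>Rounding down costs at most 1, which is at most half of
    \<open>n / k\<close>.\<close>
  then have m: "2 \<le> m" "real n / real k / 2 \<le> real m"
    using nk by (linarith, simp add: field_simps)
  have "real m \<le> real n / real k"
    using floor_divide_of_nat_eq[of n k, where 'a = real] unfolding m_def by linarith
  then have "real m \<le> real (2 ^ L)"
    unfolding of_nat_power of_nat_numeral using L(1) by (rule order_trans)
  then have mL: "m \<le> 2 ^ L"
    by (simp only: of_nat_le_iff)
  \<comment> \<open>There are \<open>k\<close> groups of \<open>L\<close> bits with two coordinates
    per bit, and \<open>L \<le> 3 * ln (n / k)\<close>: hence the constant 6.\<close>
  have "2 * real k * real L \<le> 2 * real k * (3 * ln (real n / real k))"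
    using L(2) by (intro mult_left_mono) auto
  also have "\<dots> \<le> real d"
    using d by simp
  finally have "real (2 * k * L) \<le> real d"
    by simp
  then have kL: "2 * k * L \<le> d"
    by (simp only: of_nat_le_iff)
  have "k * m \<le> n"
    by (simp add: m_def)
  obtain P p where P: "P \<subseteq> linf_space d" "finite P" "card P = n"
    and inj: "inj_on (case_prod p) ({..<k} \<times> {..<m})"
    and query: "\<And>c \<sigma>. \<lbrakk>1 \<le> k; 0 < c; c < 3; \<sigma> \<in> {..<k} \<rightarrow>\<^sub>E {..<m}\<rbrakk> \<Longrightarrow>
       \<exists>q\<in>linf_space d. nn_valid_answers (linf_dist d) c k P q \<subseteq> {(\<lambda>j. p j (\<sigma> j)) ` {..<k}}"
    by (rule exists_points_with_transversal_queries[OF m(1) \<open>k * m \<le> n\<close> mL kL \<open>1 \<le> d\<close>]) (rule that)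
  define s where "s = nat \<lceil>\<alpha> / 2\<rceil>"
  have s: "0 < s" "\<alpha> / 2 \<le> real s"
    using assms(2) unfolding s_def by linarith+
  show ?thesis
  proof (intro exI[of _ P] conjI P allI impI)
    fix \<B>
    assume \<B>: "indexing_scheme (linf_space d) P (linf_nn_queries d c k P) B \<B>"
      "worst_case_query_time \<B> (linf_nn_queries d c k P) \<le> enat (nat \<lceil>real k / \<alpha>\<rceil>)"
    have "m ^ s \<le> card \<B> * (B choose s)"
    proof (rule indexing_scheme_blocks_lower_bound[OF assms(1) m(1) P(2) inj _ \<B> assms(2,4) s_def])
      fix \<sigma> assume "\<sigma> \<in> {..<k} \<rightarrow>\<^sub>E {..<m}"
      then show "\<exists>q\<in>linf_nn_queries d c k P. q \<subseteq> {(\<lambda>j. p j (\<sigma> j)) ` {..<k}}"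
        using query[OF assms(1,5,6)] by (auto simp: linf_nn_queries_def)
    qed
    then have "real m ^ s \<le> real (card \<B>) * real (B choose s)"
      by (metis of_nat_le_iff of_nat_mult of_nat_power)
    then show "((1 / (2 * exp 1)) * sqrt ((real n / real k) * \<alpha> / real B)) powr \<alpha> \<le> real (card \<B>)"
      using s m(2) X assms(2,3) by (intro blocks_estimate[of m s _ B]) auto
  qed
qed

theorem theorem1:
  "\<exists>C>0. \<exists>K>0. \<forall>(n::nat) (k::nat) (B::nat) (d::nat) (\<alpha>::real) (c::real).
     1 \<le> k \<longrightarrow> k \<le> n \<longrightarrow> 1 \<le> \<alpha> \<longrightarrow> \<alpha> \<le> real B \<longrightarrow> \<alpha> \<le> 2 * real k \<longrightarrow>
     1 < c \<longrightarrow> c < 3 \<longrightarrow> 1 \<le> d \<longrightarrow> real d \<ge> C * (real k * ln (real n / real k)) \<longrightarrow>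
     (\<exists>P. P \<subseteq> linf_space d \<and> finite P \<and> card P = n \<and>
       (\<forall>\<B>. indexing_scheme (linf_space d) P (linf_nn_queries d c k P) B \<B> \<longrightarrow>
          worst_case_query_time \<B> (linf_nn_queries d c k P) \<le> enat (nat \<lceil>real k / \<alpha>\<rceil>) \<longrightarrow>
          real (card \<B>) \<ge>
            K * ((1 / (2 * exp 1)) * sqrt (real n * \<alpha> / (real k * real B))) powr \<alpha>))"
\<comment> \<open>The 6 is two coordinates per bit times the 3 of the bit count; \<open>K\<close> is
  1, since neither case loses a constant factor.\<close>
proof (rule exI[of _ 6], rule conjI, simp, rule exI[of _ 1], rule conjI, simp, intro allI impI)
  fix n k B d :: nat and \<alpha> c :: real
  assume a: "1 \<le> k" "k \<le> n" "1 \<le> \<alpha>" "\<alpha> \<le> real B" "\<alpha> \<le> 2 * real k" "1 < c" "c < 3" "1 \<le> d"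
    "real d \<ge> 6 * (real k * ln (real n / real k))"
  have X: "real n * \<alpha> / (real k * real B) = (real n / real k) * \<alpha> / real B"
    by simp
  show "\<exists>P. P \<subseteq> linf_space d \<and> finite P \<and> card P = n \<and>
       (\<forall>\<B>. indexing_scheme (linf_space d) P (linf_nn_queries d c k P) B \<B> \<longrightarrow>
          worst_case_query_time \<B> (linf_nn_queries d c k P) \<le> enat (nat \<lceil>real k / \<alpha>\<rceil>) \<longrightarrow>
          real (card \<B>) \<ge>
            1 * ((1 / (2 * exp 1)) * sqrt (real n * \<alpha> / (real k * real B))) powr \<alpha>)"
    unfolding X mult_1_left
  \<comment> \<open>The threshold is the ratio at which the base of the power equals 1.\<close>
  proof (cases "4 * (exp 1)\<^sup>2 \<le> (real n / real k) * \<alpha> / real B")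
    case True
    then show "\<exists>P. P \<subseteq> linf_space d \<and> finite P \<and> card P = n \<and>
       (\<forall>\<B>. indexing_scheme (linf_space d) P (linf_nn_queries d c k P) B \<B> \<longrightarrow>
          worst_case_query_time \<B> (linf_nn_queries d c k P) \<le> enat (nat \<lceil>real k / \<alpha>\<rceil>) \<longrightarrow>
          ((1 / (2 * exp 1)) * sqrt ((real n / real k) * \<alpha> / real B)) powr \<alpha> \<le> real (card \<B>))"
      using a by (intro exists_points_large_ratio) auto
  next
    case False
    then show "\<exists>P. P \<subseteq> linf_space d \<and> finite P \<and> card P = n \<and>
       (\<forall>\<B>. indexing_scheme (linf_space d) P (linf_nn_queries d c k P) B \<B> \<longrightarrow>
          worst_case_query_time \<B> (linf_nn_queries d c k P) \<le> enat (nat \<lceil>real k / \<alpha>\<rceil>) \<longrightarrow>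
          ((1 / (2 * exp 1)) * sqrt ((real n / real k) * \<alpha> / real B)) powr \<alpha> \<le> real (card \<B>))"
      using a by (intro exists_points_small_ratio) auto
  qed
qed

end
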